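(* Let $\Omega\subset\mathbb{R}$ be connected, let $f\colon\Omega\to\mathbb{R}$ be continuous, let $x^*$ be a strong local minimum point of $f$ with $y^*=f(x^* )$, and suppose that $f$ is locally coercive at $x^*$. If $f$ has a change of monotonicity at most a finite number of times, then the level-bisection algorithm described in the context converges to $x^*$. That is, there exist an open interval $I\subset\Omega$ containing $x^*$ and a number $\bar y>y^*$ such that for every $\delta\in(0,1)$, every $\tilde y<y^*$ and every $y\in(y^*,\bar y)$, the algorithm on $I$ with inputs $(\delta,\tilde y,y)$ is well defined, terminates after finitely many iterations, and returns $x_1<x_2$ with $x^*\in(x_1,x_2)$ and $|x_2-x_1|\le\delta$.
   Context: A point $x^*$ is a strong local minimum point of $f$ if there is a neighborhood of $x^*$ in $\Omega$ on which $f(x)>f(x^* )$ for all $x\ne x^*$. A continuous function $f\colon\Omega\to\mathbb{R}$ is locally coercive at $x^*$ if there exists a neighborhood $(a,b)\subset\Omega$ of $x^*$ such that $\lim_{x\to a^+}f(x)=\lim_{x\to b^-}f(x)=L\in\mathbb{R}$. The function $f$ has a change of monotonicity in an interval $J$ if there are points $r<s<t$ in $J$ with either $f(r)>f(s)$ and $f(s)<f(t)$, or $f(r)<f(s)$ and $f(s)>f(t)$. It has a change of monotonicity at most a finite number of times if there is $N\in\mathbb{N}$ such that there do not exist $N+1$ pairwise disjoint open intervals contained in $\Omega$ in each of which $f$ has a change of monotonicity. For a level $z$, say that level $z$ is solvable in $I$ if the equation $f(x)=z$ has a solution in $I$ with $x<x^*$ and a solution in $I$ with $x>x^*$. In that case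 let $x_{z,1}<x^*$ and $x_{z,2}>x^*$ be the solutions in $I$ closest to $x^*$ on the left and on the right respectively. Level-bisection algorithm on $I$, with inputs $\delta>0$, $\tilde y<y^*$ and $y>y^*$ (equations are assumed to be solved exactly): 1. Set $(x_1,x_2)=(x_{y,1},x_{y,2})$. 2. While $|x_2-x_1|>\delta$: set $\mathrm{temp}=(y+\tilde y)/2$. If level $\mathrm{temp}$ is solvable in $I$, set $(x_1,x_2)=(x_{\mathrm{temp},1},x_{\mathrm{temp},2})$ and $y=\mathrm{temp}$. Otherwise set $\tilde y=\mathrm{temp}$ and keep $(x_1,x_2)$. 3. Return $x_1,x_2$. *)

theory Defs
  imports "HOL-Analysis.Analysis" "HOL-Library.While_Combinator"
begin

text \<open>Functions \<open>\<Omega> \<rightarrow> \<real>\<close> are rendered as total functions on the reals of which only the values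
  on \<open>\<Omega>\<close> are used.\<close>

definition strong_local_min :: "real set \<Rightarrow> (real \<Rightarrow> real) \<Rightarrow> real \<Rightarrow> bool" where
  "strong_local_min \<Omega> f xs \<longleftrightarrow>
     xs \<in> \<Omega> \<and> (\<exists>U. open U \<and> xs \<in> U \<and> (\<forall>x \<in> U \<inter> \<Omega>. x \<noteq> xs \<longrightarrow> f x > f xs))"

text \<open>The endpoints \<open>a\<close> and \<open>b\<close> need not belong to \<open>\<Omega>\<close>; the one-sided limits only depend on the
  values of \<open>f\<close> on \<open>{a<..<b}\<close>.\<close>

definition locally_coercive :: "real set \<Rightarrow> (real \<Rightarrow> real) \<Rightarrow> real \<Rightarrow> bool" where
  "locally_coercive \<Omega> f xs \<longleftrightarrow>
     (\<exists>a b L. xs \<in> {a<..<b} \<and> {a<..<b} \<subseteq> \<Omega> \<and>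
        (f \<longlongrightarrow> L) (at_right a) \<and> (f \<longlongrightarrow> L) (at_left b))"

definition open_interval :: "real set \<Rightarrow> bool" where
  "open_interval J \<longleftrightarrow> open J \<and> is_interval J"

definition monotonicity_change :: "(real \<Rightarrow> real) \<Rightarrow> real set \<Rightarrow> bool" where
  "monotonicity_change f J \<longleftrightarrow>
     (\<exists>r \<in> J. \<exists>s \<in> J. \<exists>t \<in> J. r < s \<and> s < t \<and>
        (f r > f s \<and> f s < f t \<or> f r < f s \<and> f s > f t))"

text \<open>An interval with a change of monotonicity is nonempty, so pairwise disjoint intervals of this
  kind are distinct, and a set of intervals can be used instead of an indexed family.\<close>

definition finitely_many_monotonicity_changes :: "real set \<Rightarrow> (real \<Rightarrow> real) \<Rightarrow> bool" where
  "finitely_many_monotonicity_changes \<Omega> f \<longleftrightarrow>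
     (\<exists>N::nat. \<not> (\<exists>\<J>. finite \<J> \<and> card \<J> = N + 1 \<and> disjoint \<J> \<and>
        (\<forall>J \<in> \<J>. open_interval J \<and> J \<subseteq> \<Omega> \<and> monotonicity_change f J)))"

definition left_solution :: "(real \<Rightarrow> real) \<Rightarrow> real set \<Rightarrow> real \<Rightarrow> real \<Rightarrow> real \<Rightarrow> bool" where
  "left_solution f I xs z x \<longleftrightarrow> x \<in> I \<and> x < xs \<and> f x = z"

definition right_solution :: "(real \<Rightarrow> real) \<Rightarrow> real set \<Rightarrow> real \<Rightarrow> real \<Rightarrow> real \<Rightarrow> bool" where
  "right_solution f I xs z x \<longleftrightarrow> x \<in> I \<and> x > xs \<and> f x = z"

definition level_solvable :: "(real \<Rightarrow> real) \<Rightarrow> real set \<Rightarrow> real \<Rightarrow> real \<Rightarrow> bool" where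
  "level_solvable f I xs z \<longleftrightarrow>
     (\<exists>x. left_solution f I xs z x) \<and> (\<exists>x. right_solution f I xs z x)"

text \<open>The points $x_{z,1}$ and $x_{z,2}$. Their values are meaningful only if closest solutions exist,
  which is what \<open>closest_solutions_exist\<close> records: a solvable level might a priori have solutions
  approaching \<open>xs\<close> without a closest one.\<close>

definition closest_left :: "(real \<Rightarrow> real) \<Rightarrow> real set \<Rightarrow> real \<Rightarrow> real \<Rightarrow> real" where
  "closest_left f I xs z = arg_min (\<lambda>x. dist x xs) (left_solution f I xs z)"

definition closest_right :: "(real \<Rightarrow> real) \<Rightarrow> real set \<Rightarrow> real \<Rightarrow> real \<Rightarrow> real" where
  "closest_right f I xs z = arg_min (\<lambda>x. dist x xs) (right_solution f I xs z)"

definition closest_solutions_exist :: "(real \<Rightarrow> real) \<Rightarrow> real set \<Rightarrow> real \<Rightarrow> real \<Rightarrow> bool" where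
  "closest_solutions_exist f I xs z \<longleftrightarrow>
     (\<exists>x. is_arg_min (\<lambda>x. dist x xs) (left_solution f I xs z) x) \<and>
     (\<exists>x. is_arg_min (\<lambda>x. dist x xs) (right_solution f I xs z) x)"

text \<open>The state of the level-bisection algorithm is \<open>(y', y, x1, x2)\<close>, where \<open>y'\<close> is the lower level
  $\tilde y$.\<close>

type_synonym lb_state = "real \<times> real \<times> real \<times> real"

definition lb_init :: "(real \<Rightarrow> real) \<Rightarrow> real set \<Rightarrow> real \<Rightarrow> real \<Rightarrow> real \<Rightarrow> lb_state" where
  "lb_init f I xs y' y = (y', y, closest_left f I xs y, closest_right f I xs y)"

definition lb_guard :: "real \<Rightarrow> lb_state \<Rightarrow> bool" where
  "lb_guard \<delta> = (\<lambda>(y', y, x1, x2). \<bar>x2 - x1\<bar> > \<delta>)"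

definition lb_temp :: "lb_state \<Rightarrow> real" where
  "lb_temp = (\<lambda>(y', y, x1, x2). (y + y') / 2)"

definition lb_step :: "(real \<Rightarrow> real) \<Rightarrow> real set \<Rightarrow> real \<Rightarrow> lb_state \<Rightarrow> lb_state" where
  "lb_step f I xs s = (case s of (y', y, x1, x2) \<Rightarrow>
     (let temp = lb_temp s in
        if level_solvable f I xs temp
        then (y', temp, closest_left f I xs temp, closest_right f I xs temp)
        else (temp, y, x1, x2)))"

text \<open>The result is \<open>None\<close> iff the loop does not terminate.\<close>

definition level_bisection ::
    "(real \<Rightarrow> real) \<Rightarrow> real set \<Rightarrow> real \<Rightarrow> real \<Rightarrow> real \<Rightarrow> real \<Rightarrow> (real \<times> real) option" where
  "level_bisection f I xs \<delta> y' y =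
     map_option (\<lambda>(y', y, x1, x2). (x1, x2))
       (while_option (lb_guard \<delta>) (lb_step f I xs) (lb_init f I xs y' y))"

text \<open>The algorithm is well defined if the initial level is solvable and if the closest solutions
  exist for the initial level and for every solvable level considered in an iteration of the loop
  that is actually executed.\<close>

definition level_bisection_well_defined ::
    "(real \<Rightarrow> real) \<Rightarrow> real set \<Rightarrow> real \<Rightarrow> real \<Rightarrow> real \<Rightarrow> real \<Rightarrow> bool" where
  "level_bisection_well_defined f I xs \<delta> y' y \<longleftrightarrow>
     level_solvable f I xs y \<and> closest_solutions_exist f I xs y \<and>
     (\<forall>k. let s = (\<lambda>j. (lb_step f I xs ^^ j) (lb_init f I xs y' y)) in
        (\<forall>j\<le>k. lb_guard \<delta> (s j)) \<and> level_solvable f I xs (lb_temp (s k)) \<longrightarrow>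
        closest_solutions_exist f I xs (lb_temp (s k)))"

end

theory Submission
  imports Defs
begin

text \<open>On a small open interval \<open>I\<close> around the strict minimum point \<open>xs\<close>, a level is solvable if it
  lies slightly above \<open>f xs\<close>, by the intermediate value theorem, and unsolvable if it is at most
  \<open>f xs\<close>. So the bracket of levels always contains \<open>f xs\<close> and is halved in each iteration, and the
  upper level tends to \<open>f xs\<close>. As soon as it is below both \<open>f (xs - \<eta>)\<close> and \<open>f (xs + \<eta>)\<close>, the
  closest solutions are within \<open>\<eta>\<close> of \<open>xs\<close>. The role of coercivity is to make
  \<open>xs\<close> an interior point of \<open>\<Omega>\<close>.\<close>

text \<open>The solutions in the compact segment from a known solution \<open>c\<close> to
  \<open>p\<close> form a nonempty closed set, so one of them is nearest to \<open>p\<close>; a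
  point satisfying \<open>P\<close> outside the segment is no nearer than \<open>c\<close>. Using
  \<open>closed_segment\<close> lets one lemma serve both sides of \<open>xs\<close>.\<close>

lemma is_arg_min_dist_exists:
  fixes f :: "real \<Rightarrow> real"
  assumes "continuous_on (closed_segment c p) f" and "f c = z"
    and segment: "\<And>x. x \<in> closed_segment c p \<Longrightarrow> f x = z \<Longrightarrow> P x"
    and outside: "\<And>x. P x \<Longrightarrow> f x = z \<and> (x \<in> closed_segment c p \<or> dist c p \<le> dist x p)"
  shows "\<exists>x. is_arg_min (\<lambda>x. dist x p) P x"
proof -
  let ?S = "{x \<in> closed_segment c p. f x = z}"
  have "closed ?S"
    using assms(1) by (intro continuous_closed_preimage_constant) auto
  moreover have c: "c \<in> ?S"
    using assms(2) by simp
  ultimately obtain x where x: "x \<in> ?S" "\<And>y. y \<in> ?S \<Longrightarrow> dist p x \<le> dist p y"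
    using distance_attains_inf[of ?S p] by blast
  have "dist x p \<le> dist y p" if "P y" for y
    using outside[OF that] x(2)[of y] x(2)[OF c] by (auto simp: dist_commute)
  then show ?thesis
    using x(1) segment unfolding is_arg_min_def by (auto simp: not_less)
qed

text \<open>\<open>arg_min\<close> is a Hilbert choice, so the existence of a minimizer is enough to
  make its value meaningful.\<close>

lemma is_arg_min_arg_min: "\<exists>x. is_arg_min g P x \<Longrightarrow> is_arg_min g P (arg_min g P)"
  unfolding arg_min_def by (rule someI_ex)

locale strict_min_on_interval =
  fixes f :: "real \<Rightarrow> real" and I :: "real set" and xs :: real
  assumes interval: "is_interval I"
    and xs_in: "xs \<in> I"
    and cont: "continuous_on I f"
    and strict_min: "\<And>x. x \<in> I \<Longrightarrow> x \<noteq> xs \<Longrightarrow> f xs < f x"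
begin

lemma segment_subset: "c \<in> I \<Longrightarrow> closed_segment c xs \<subseteq> I"
  using interval xs_in is_interval_convex_1 closed_segment_subset by blast

lemma level_solvable_imp_gt:
  assumes "level_solvable f I xs z"
  shows "f xs < z"
  using assms strict_min unfolding level_solvable_def left_solution_def by force

text \<open>Strictness of both level inequalities keeps the intermediate value off the endpoints.
  The bound \<open>x > c\<close> later confines the closest solution.\<close>

lemma left_solution_exists:
  assumes "c \<in> I" "c < xs" "f xs < z" "z < f c"
  shows "\<exists>x>c. left_solution f I xs z x"
proof -
  have "{c..xs} \<subseteq> I"
    using segment_subset[OF assms(1)] assms(2) by (simp add: closed_segment_eq_real_ivl)
  moreover from this obtain x where "c \<le> x" "x \<le> xs" "f x = z"
    using IVT2'[of f xs z c] assms continuous_on_subset[OF cont] by force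
  moreover have "x \<noteq> c" "x \<noteq> xs"
    using assms \<open>f x = z\<close> by auto
  ultimately show ?thesis
    unfolding left_solution_def by (intro exI[of _ x]) auto
qed

lemma right_solution_exists:
  assumes "d \<in> I" "xs < d" "f xs < z" "z < f d"
  shows "\<exists>x<d. right_solution f I xs z x"
proof -
  have "{xs..d} \<subseteq> I"
    using segment_subset[OF assms(1)] assms(2) by (simp add: closed_segment_eq_real_ivl)
  moreover from this obtain x where "xs \<le> x" "x \<le> d" "f x = z"
    using IVT'[of f xs z d] assms continuous_on_subset[OF cont] by force
  moreover have "x \<noteq> d" "x \<noteq> xs"
    using assms \<open>f x = z\<close> by auto
  ultimately show ?thesis
    unfolding right_solution_def by (intro exI[of _ x]) auto
qed

lemma level_solvableI:
  assumes "c \<in> I" "c < xs" "d \<in> I" "xs < d" "f xs < z" "z < f c" "z < f d"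
  shows "level_solvable f I xs z"
  using left_solution_exists[of c z] right_solution_exists[of d z] assms
  unfolding level_solvable_def by blast

lemma closest_solutions_exist:
  assumes "level_solvable f I xs z"
  shows "closest_solutions_exist f I xs z"
proof -
  \<comment> \<open>The segments below contain \<open>xs\<close>; this excludes it as a solution, so
    the minimizer lies strictly on its own side.\<close>
  have z: "z \<noteq> f xs"
    using level_solvable_imp_gt[OF assms] by simp
  obtain c d where c: "left_solution f I xs z c" and d: "right_solution f I xs z d"
    using assms unfolding level_solvable_def by blast
  have "\<exists>x. is_arg_min (\<lambda>x. dist x xs) (left_solution f I xs z) x"
  proof (rule is_arg_min_dist_exists)
    have sub: "closed_segment c xs \<subseteq> I"
      using c segment_subset unfolding left_solution_def by blast
    then show "continuous_on (closed_segment c xs) f"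
      using cont continuous_on_subset by blast
    show "f c = z"
      using c unfolding left_solution_def by blast
    show "left_solution f I xs z x" if "x \<in> closed_segment c xs" "f x = z" for x
    proof -
      have "x \<noteq> xs"
        using that z by auto
      then show ?thesis
        using that c sub unfolding left_solution_def by (auto simp: closed_segment_eq_real_ivl)
    qed
    show "f x = z \<and> (x \<in> closed_segment c xs \<or> dist c xs \<le> dist x xs)"
      if "left_solution f I xs z x" for x
      using that c unfolding left_solution_def
      by (auto simp: closed_segment_eq_real_ivl dist_real_def)
  qed
  moreover have "\<exists>x. is_arg_min (\<lambda>x. dist x xs) (right_solution f I xs z) x"
  proof (rule is_arg_min_dist_exists)
    have sub: "closed_segment d xs \<subseteq> I"
      using d segment_subset unfolding right_solution_def by blast
    then show "continuous_on (closed_segment d xs) f"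
      using cont continuous_on_subset by blast
    show "f d = z"
      using d unfolding right_solution_def by blast
    show "right_solution f I xs z x" if "x \<in> closed_segment d xs" "f x = z" for x
    proof -
      have "x \<noteq> xs"
        using that z by auto
      then show ?thesis
        using that d sub unfolding right_solution_def by (auto simp: closed_segment_eq_real_ivl)
    qed
    show "f x = z \<and> (x \<in> closed_segment d xs \<or> dist d xs \<le> dist x xs)"
      if "right_solution f I xs z x" for x
      using that d unfolding right_solution_def
      by (auto simp: closed_segment_eq_real_ivl dist_real_def)
  qed
  ultimately show ?thesis
    unfolding closest_solutions_exist_def by blast
qed

lemma closest_left_is_arg_min:
  assumes "level_solvable f I xs z"
  shows "is_arg_min (\<lambda>x. dist x xs) (left_solution f I xs z) (closest_left f I xs z)"
  using closest_solutions_exist[OF assms]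
  unfolding closest_solutions_exist_def closest_left_def
  by (intro is_arg_min_arg_min) (rule conjunct1)

lemma closest_right_is_arg_min:
  assumes "level_solvable f I xs z"
  shows "is_arg_min (\<lambda>x. dist x xs) (right_solution f I xs z) (closest_right f I xs z)"
  using closest_solutions_exist[OF assms]
  unfolding closest_solutions_exist_def closest_right_def
  by (intro is_arg_min_arg_min) (rule conjunct2)

lemma closest_left_less: "level_solvable f I xs z \<Longrightarrow> closest_left f I xs z < xs"
  using closest_left_is_arg_min[of z] by (simp add: is_arg_min_def left_solution_def)

lemma closest_right_greater: "level_solvable f I xs z \<Longrightarrow> xs < closest_right f I xs z"
  using closest_right_is_arg_min[of z] by (simp add: is_arg_min_def right_solution_def)

text \<open>Some solution lies strictly between \<open>c\<close> and \<open>xs\<close>, and the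
  closest one is at least as near to \<open>xs\<close>.\<close>

lemma closest_left_greater:
  assumes "level_solvable f I xs z" "c \<in> I" "c < xs" "z < f c"
  shows "c < closest_left f I xs z"
proof -
  obtain x where x: "c < x" "left_solution f I xs z x"
    using left_solution_exists level_solvable_imp_gt assms by blast
  then have "dist (closest_left f I xs z) xs \<le> dist x xs"
    using closest_left_is_arg_min[OF assms(1)] unfolding is_arg_min_def by force
  then show ?thesis
    using x closest_left_less[OF assms(1)] by (auto simp: dist_real_def left_solution_def)
qed

lemma closest_right_less:
  assumes "level_solvable f I xs z" "d \<in> I" "xs < d" "z < f d"
  shows "closest_right f I xs z < d"
proof -
  obtain x where x: "x < d" "right_solution f I xs z x"
    using right_solution_exists level_solvable_imp_gt assms by blast
  then have "dist (closest_right f I xs z) xs \<le> dist x xs"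
    using closest_right_is_arg_min[OF assms(1)] unfolding is_arg_min_def by force
  then show ?thesis
    using x closest_right_greater[OF assms(1)] by (auto simp: dist_real_def right_solution_def)
qed

text \<open>The whole state is determined by the bracket \<open>v\<close>, \<open>u\<close> of
  levels. The bound \<open>v \<le> f xs\<close> has to be weak: a midpoint equal to
  \<open>f xs\<close> is unsolvable and becomes the new lower level.\<close>

lemma lb_iterate_invariant:
  assumes solvable: "\<And>z. f xs < z \<Longrightarrow> z \<le> y \<Longrightarrow> level_solvable f I xs z"
    and "y' \<le> f xs" "f xs < y"
  shows "\<exists>v u. (lb_step f I xs ^^ k) (lb_init f I xs y' y) =
      (v, u, closest_left f I xs u, closest_right f I xs u) \<and>
    v \<le> f xs \<and> f xs < u \<and> u \<le> y \<and> u - v = (y - y') / 2 ^ k"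
proof (induction k)
  case 0
  show ?case
    using assms(2,3) by (simp add: lb_init_def)
next
  case (Suc k)
  then obtain v u where s: "(lb_step f I xs ^^ k) (lb_init f I xs y' y) =
      (v, u, closest_left f I xs u, closest_right f I xs u)"
    and b: "v \<le> f xs" "f xs < u" "u \<le> y" "u - v = (y - y') / 2 ^ k"
    by blast
  let ?m = "(u + v) / 2"
  have half: "?m - v = (y - y') / 2 ^ Suc k" "u - ?m = (y - y') / 2 ^ Suc k"
    using b(4) by (simp_all add: field_simps)
  have step: "(lb_step f I xs ^^ Suc k) (lb_init f I xs y' y) =
      lb_step f I xs (v, u, closest_left f I xs u, closest_right f I xs u)"
    using s by simp
  show ?case
  proof (cases "level_solvable f I xs ?m")
    case True
    then show ?thesis
      unfolding step using b half(1) level_solvable_imp_gt[OF True]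
      by (intro exI[of _ v] exI[of _ ?m]) (simp add: lb_step_def lb_temp_def Let_def)
  next
    case False
    \<comment> \<open>The midpoint is at most \<open>u\<close>, hence at most \<open>y\<close>, so
      it can fail to be solvable only by not exceeding \<open>f xs\<close>.\<close>
    then have "?m \<le> f xs"
      using solvable[of ?m] b by force
    then show ?thesis
      unfolding step using False b half(2)
      by (intro exI[of _ ?m] exI[of _ u]) (simp add: lb_step_def lb_temp_def Let_def)
  qed
qed

lemma level_bisection_correct:
  assumes "open I"
    and solvable: "\<And>z. f xs < z \<Longrightarrow> z \<le> y \<Longrightarrow> level_solvable f I xs z"
    and y: "y' \<le> f xs" "f xs < y"
    and "0 < \<delta>"
  shows "level_bisection_well_defined f I xs \<delta> y' y"
    and "\<exists>x1 x2. level_bisection f I xs \<delta> y' y = Some (x1, x2) \<and>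
           x1 < xs \<and> xs < x2 \<and> \<bar>x2 - x1\<bar> \<le> \<delta>"
proof -
  show "level_bisection_well_defined f I xs \<delta> y' y"
    using solvable[of y] y closest_solutions_exist
    unfolding level_bisection_well_defined_def by (auto simp: Let_def)
next
  let ?s = "\<lambda>k. (lb_step f I xs ^^ k) (lb_init f I xs y' y)"
  note inv = lb_iterate_invariant[OF solvable y]
  obtain e where e: "0 < e" "ball xs e \<subseteq> I"
    using \<open>open I\<close> xs_in open_contains_ball by blast
  \<comment> \<open>The bound \<open>\<delta> / 2\<close> makes an interval of radius
    \<open>\<eta>\<close> no longer than \<open>\<delta>\<close>; the bound \<open>e / 2\<close>
    keeps \<open>xs - \<eta>\<close> and \<open>xs + \<eta>\<close> inside \<open>I\<close>.\<close>
  define \<eta> where "\<eta> = min (\<delta> / 2) (e / 2)"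
  have \<eta>: "0 < \<eta>" "\<eta> \<le> \<delta> / 2" "xs - \<eta> \<in> I" "xs + \<eta> \<in> I"
    using e \<open>0 < \<delta>\<close> by (auto simp: \<eta>_def dist_real_def intro!: subsetD[OF e(2)])
  \<comment> \<open>Since \<open>v \<le> f xs\<close>, a bracket narrower than \<open>h\<close> has
    its upper level below \<open>f\<close> at both test points.\<close>
  define h where "h = min (f (xs - \<eta>)) (f (xs + \<eta>)) - f xs"
  have "0 < h"
    using strict_min \<eta> by (simp add: h_def)
  then obtain k where k: "(1 / 2) ^ k < h / (y - y')"
    using y real_arch_pow_inv[of "h / (y - y')" "1 / 2"] by auto
  have "\<not> lb_guard \<delta> (?s k)"
  proof -
    obtain v u where s: "?s k = (v, u, closest_left f I xs u, closest_right f I xs u)"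
      and b: "v \<le> f xs" "f xs < u" "u \<le> y" "u - v = (y - y') / 2 ^ k"
      using inv by blast
    have "(y - y') / 2 ^ k < h"
      using k y by (simp add: field_simps)
    then have "u - v < h"
      using b(4) by simp
    then have "u < f (xs - \<eta>)" "u < f (xs + \<eta>)"
      using b(1) by (auto simp: h_def)
    then have "xs - \<eta> < closest_left f I xs u" "closest_right f I xs u < xs + \<eta>"
      using closest_left_greater closest_right_less solvable b \<eta> by auto
    then show ?thesis
      using \<eta>(2) closest_left_less[of u] closest_right_greater[of u] solvable[of u] b s
      by (simp add: lb_guard_def)
  qed
  \<comment> \<open>The loop stops at the least index \<open>j\<close> where the guard fails,
    possibly before \<open>k\<close>. The failed guard itself bounds the length, and the invariant
    at \<open>j\<close> gives the enclosure of \<open>xs\<close>.\<close>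
  then obtain j where j: "\<not> lb_guard \<delta> (?s j)"
    and w: "while_option (lb_guard \<delta>) (lb_step f I xs) (lb_init f I xs y' y) = Some (?s j)"
    unfolding while_option_def by (metis (mono_tags, lifting) LeastI)
  obtain v u where s: "?s j = (v, u, closest_left f I xs u, closest_right f I xs u)"
    and "f xs < u" "u \<le> y"
    using inv by blast
  then show "\<exists>x1 x2. level_bisection f I xs \<delta> y' y = Some (x1, x2) \<and>
           x1 < xs \<and> xs < x2 \<and> \<bar>x2 - x1\<bar> \<le> \<delta>"
    using j w closest_left_less[of u] closest_right_greater[of u] solvable[of u]
    by (simp add: level_bisection_def lb_guard_def)
qed

end

theorem corollary3p1:
  fixes \<Omega> :: "real set" and f :: "real \<Rightarrow> real" and xs ys :: real
  assumes "connected \<Omega>"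
    and "continuous_on \<Omega> f"
    and "strong_local_min \<Omega> f xs"
    and "ys = f xs"
    and "locally_coercive \<Omega> f xs"
    and "finitely_many_monotonicity_changes \<Omega> f"
  shows "\<exists>I ybar. open_interval I \<and> I \<subseteq> \<Omega> \<and> xs \<in> I \<and> ybar > ys \<and>
    (\<forall>\<delta> \<in> {0<..<1}. \<forall>y' < ys. \<forall>y \<in> {ys<..<ybar}.
       level_bisection_well_defined f I xs \<delta> y' y \<and>
       (\<exists>x1 x2. level_bisection f I xs \<delta> y' y = Some (x1, x2) \<and>
          x1 < x2 \<and> xs \<in> {x1<..<x2} \<and> \<bar>x2 - x1\<bar> \<le> \<delta>))"
proof -
  obtain U where U: "open U" "xs \<in> U" "\<And>x. x \<in> U \<Longrightarrow> x \<in> \<Omega> \<Longrightarrow> x \<noteq> xs \<Longrightarrow> f xs < f x"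
    using assms(3) unfolding strong_local_min_def by blast
  obtain a b where ab: "xs \<in> {a<..<b}" "{a<..<b} \<subseteq> \<Omega>"
    using assms(5) unfolding locally_coercive_def by blast
  have "open (U \<inter> {a<..<b})" "xs \<in> U \<inter> {a<..<b}"
    using U ab by auto
  \<comment> \<open>On this ball the minimum is strict throughout, and the ball lies in
    \<open>\<Omega>\<close>.\<close>
  then obtain e where e: "0 < e" "ball xs e \<subseteq> U \<inter> {a<..<b}"
    using open_contains_ball by meson
  let ?I = "ball xs e"
  have sub: "?I \<subseteq> \<Omega>"
    using e ab by blast
  have interval: "is_interval ?I"
    by (simp add: is_interval_ball_real)
  interpret strict_min_on_interval f ?I xs
  proof
    show "f xs < f x" if "x \<in> ?I" "x \<noteq> xs" for x
      using that e(2) sub U(3) by blast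
  qed (use interval e sub continuous_on_subset[OF assms(2)] in auto)
  \<comment> \<open>Every level strictly between \<open>ys\<close> and \<open>ybar\<close> is
    crossed on both sides of \<open>xs\<close>; half the radius keeps the two test points inside the
    open ball.\<close>
  define ybar where "ybar = min (f (xs - e / 2)) (f (xs + e / 2))"
  have I: "xs - e / 2 \<in> ?I" "xs + e / 2 \<in> ?I"
    using e by (auto simp: dist_real_def)
  have "ys < ybar"
    using strict_min I e assms(4) by (simp add: ybar_def)
  moreover have "level_solvable f ?I xs z" if "f xs < z" "z < ybar" for z
    using level_solvableI[of "xs - e / 2" "xs + e / 2" z] I e that by (simp add: ybar_def)
  then have "level_bisection_well_defined f ?I xs \<delta> y' y \<and>
       (\<exists>x1 x2. level_bisection f ?I xs \<delta> y' y = Some (x1, x2) \<and>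
          x1 < x2 \<and> xs \<in> {x1<..<x2} \<and> \<bar>x2 - x1\<bar> \<le> \<delta>)"
    if "0 < \<delta>" "y' < ys" "ys < y" "y < ybar" for \<delta> y' y
    using level_bisection_correct[of y y' \<delta>] that assms(4) by fastforce
  ultimately show ?thesis
    using interval sub xs_in
    by (intro exI[of _ ?I] exI[of _ ybar]) (auto simp: open_interval_def)
qed

end
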